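(* Let $\Phi=\{\phi_1,\ldots,\phi_N\}$, $N\geq 2$, be an iterated function system of contracting similarities of $\mathbb{R}$ that satisfies the open set condition and is lattice, and let $F\subseteq\mathbb{R}$ be the self-similar set generated by $\Phi$. If $F$ is nontrivial, i.e. $\dim_M(F)<1$, then $F$ is not Minkowski measurable.
   Context: Let $\Phi=\{\phi_1,\ldots,\phi_N\}$ be an iterated function system (IFS) consisting of $N\ge 2$ contracting similarities $\phi_i:\mathbb{R}\to\mathbb{R}$, with similarity ratios $r_i\in(0,1)$, and let $\Sigma=\{1,\ldots,N\}$. Open set condition (OSC): there exists a nonempty open set $O\subseteq\mathbb{R}$ with $\phi_i(O)\subseteq O$ for all $i\in\Sigma$ and $\phi_i(O)\cap\phi_j(O)=\emptyset$ for all $i\neq j$ in $\Sigma$. $\Phi$ is lattice if $\{\log r_i : i\in\Sigma\}$ generates a discrete subgroup of $(\mathbb{R},+)$; otherwise it is nonlattice. The self-similar set generated by (associated with) $\Phi$ is the unique nonempty compact set $F\subseteq\mathbb{R}$ with $F=\bigcup_{i\in\Sigma}\phi_i(F)$. For compact $A\subseteq\mathbb{R}$ and $\varepsilon>0$ let $A_\varepsilon=\{x\in\mathbb{R}: \inf_{a\in A}|x-a|\le\varepsilon\}$, and let $\lambda$ be Lebesgue measure on $\mathbb{R}$. The Minkowski dimension is $\dim_M(A)=1-\lim_{\varepsilon\searrow0}\log(\lambda(A_\varepsilon))/\log(\varepsilon)$ if the limit exists (it is well known that it exists for $F$ under OSC). The Minkowski content is $\mathcal{M}(A)=\lim_{\varepsilon\searrow0}\varepsilon^{\dim_M(A)-1}\lambda(A_\varepsilon)$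 if the limit exists. $A$ is Minkowski measurable if $\mathcal{M}(A)$ exists and is positive and finite. $F$ is nontrivial if $\dim_M(F)<1$. *)

theory Defs
  imports "HOL-Analysis.Analysis" "HOL-Computational_Algebra.Group_Closure"
begin

definition contracting_similarity :: "(real \<Rightarrow> real) \<Rightarrow> real \<Rightarrow> bool" where
  "contracting_similarity f \<rho> \<longleftrightarrow>
     0 < \<rho> \<and> \<rho> < 1 \<and> (\<forall>x y. dist (f x) (f y) = \<rho> * dist x y)"

text \<open>The maps and their ratios are families on the index set \<open>{1..N}\<close>; their values at other
  indices are irrelevant.\<close>

definition similarity_ifs :: "nat \<Rightarrow> (nat \<Rightarrow> real \<Rightarrow> real) \<Rightarrow> (nat \<Rightarrow> real) \<Rightarrow> bool" where
  "similarity_ifs N \<phi> r \<longleftrightarrow> N \<ge> 2 \<and> (\<forall>i\<in>{1..N}. contracting_similarity (\<phi> i) (r i))"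

definition open_set_condition :: "nat \<Rightarrow> (nat \<Rightarrow> real \<Rightarrow> real) \<Rightarrow> bool" where
  "open_set_condition N \<phi> \<longleftrightarrow>
     (\<exists>U. open U \<and> U \<noteq> {} \<and> (\<forall>i\<in>{1..N}. \<phi> i ` U \<subseteq> U) \<and>
          (\<forall>i\<in>{1..N}. \<forall>j\<in>{1..N}. i \<noteq> j \<longrightarrow> \<phi> i ` U \<inter> \<phi> j ` U = {}))"

definition lattice_ratios :: "nat \<Rightarrow> (nat \<Rightarrow> real) \<Rightarrow> bool" where
  "lattice_ratios N r \<longleftrightarrow> discrete (group_closure ((\<lambda>i. ln (r i)) ` {1..N}))"

definition self_similar_set :: "nat \<Rightarrow> (nat \<Rightarrow> real \<Rightarrow> real) \<Rightarrow> real set \<Rightarrow> bool" where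
  "self_similar_set N \<phi> F \<longleftrightarrow> compact F \<and> F \<noteq> {} \<and> F = (\<Union>i\<in>{1..N}. \<phi> i ` F)"

text \<open>By the convention for \<^const>\<open>infdist\<close>, the parallel set of the empty set is the whole line
  rather than empty; only nonempty sets are of interest below.\<close>

definition parallel_set :: "real set \<Rightarrow> real \<Rightarrow> real set" where
  "parallel_set A \<epsilon> = {x. infdist x A \<le> \<epsilon>}"

definition parallel_volume :: "real set \<Rightarrow> real \<Rightarrow> real" where
  "parallel_volume A \<epsilon> = measure lebesgue (parallel_set A \<epsilon>)"

definition minkowski_dim_exists :: "real set \<Rightarrow> bool" where
  "minkowski_dim_exists A \<longleftrightarrow>
     (\<exists>l. ((\<lambda>\<epsilon>. ln (parallel_volume A \<epsilon>) / ln \<epsilon>) \<longlongrightarrow> l) (at_right 0))"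

text \<open>The value of \<open>minkowski_dim A\<close> is unspecified unless \<open>minkowski_dim_exists A\<close>.\<close>

definition minkowski_dim :: "real set \<Rightarrow> real" where
  "minkowski_dim A = 1 - Lim (at_right 0) (\<lambda>\<epsilon>. ln (parallel_volume A \<epsilon>) / ln \<epsilon>)"

text \<open>The Minkowski content presupposes the Minkowski dimension. It is a real number here, so
  an infinite limit does not count.\<close>

definition has_minkowski_content :: "real set \<Rightarrow> real \<Rightarrow> bool" where
  "has_minkowski_content A M \<longleftrightarrow>
     minkowski_dim_exists A \<and>
     ((\<lambda>\<epsilon>. \<epsilon> powr (minkowski_dim A - 1) * parallel_volume A \<epsilon>) \<longlongrightarrow> M) (at_right 0)"

definition minkowski_measurable :: "real set \<Rightarrow> bool" where
  "minkowski_measurable A \<longleftrightarrow> (\<exists>M. has_minkowski_content A M \<and> 0 < M)"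

end

theory Submission
  imports Defs
begin

text \<open>Minkowski measurability contradicts the presence of too many gaps of exactly the same length.

  The parallel volume \<open>V\<close> of a compact set has a kink at half the length of each of its gaps: as long
  as \<open>\<epsilon>\<close> is below half the length, the gap contributes \<open>2 * \<epsilon>\<close>, and afterwards a constant. So
  if \<open>n\<close> gaps have length \<open>2 * \<epsilon>\<close>, the second difference of \<open>V\<close> at \<open>\<epsilon>\<close> with step \<open>h * \<epsilon>\<close> is at most
  \<open>- 2 * n * h * \<epsilon>\<close> (\<open>parallel_volume_kink\<close>). If \<open>V\<close> is asymptotic to \<open>M * \<epsilon> powr p\<close>, then \<open>n * \<epsilon>\<close> must
  therefore be of smaller order than \<open>V \<epsilon>\<close>, since the limit function is differentiable
  (\<open>no_kinks_in_power_asymptotics\<close>).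

  A lattice system violates this. By the open set condition there is a piece \<open>f u ` F\<close> with a
  maximal number of neighbouring pieces, and \<open>f w\<close>, for every word \<open>w\<close>, reproduces the part of \<open>F\<close> near
  that piece without any new points of \<open>F\<close> coming in (\<open>maximal_neighbourhood_piece\<close>). As \<open>F\<close> has
  length zero when its dimension is below one and its content is finite, there is a gap near
  the piece, and all its images under the maps \<open>f w\<close> are gaps of \<open>F\<close> (\<open>gap_copied_by_all_words\<close>).
  Restrict \<open>w\<close> to the words whose ratio is comparable to \<open>t\<close>. Their pieces cover \<open>F\<close>, so their
  number is at least a constant times \<open>V t / t\<close>; and for a lattice system their ratios take only
  boundedly many values (\<open>lattice_bounded_ratio_values\<close>). By the pigeonhole principle at least a constant
  times \<open>V t / t\<close> gaps share one length comparable to \<open>t\<close> (\<open>many_equal_gaps\<close>).\<close>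

section \<open>Parallel volume at a kink\<close>

text \<open>A gap is given by its midpoint and half its length, because the kink that it causes in the
  parallel volume sits exactly at half its length.\<close>

definition gap :: "real set \<Rightarrow> real \<Rightarrow> real \<Rightarrow> bool" where
  "gap F m l \<longleftrightarrow> 0 < l \<and> m - l \<in> F \<and> m + l \<in> F \<and> F \<inter> {m - l<..<m + l} = {}"

lemma gap_avoids: "gap F m l \<Longrightarrow> z \<in> F \<Longrightarrow> z \<le> m - l \<or> m + l \<le> z"
  by (force simp: gap_def)

lemma length_Ioo: "a \<le> b \<Longrightarrow> measure lebesgue {a<..<b::real} = b - a"
  by (simp add: measure_completion)

lemma measure_disjoint_Ioo_union:
  fixes c :: "'a \<Rightarrow> real"
  assumes "finite I" "0 \<le> \<eta>"
    and "pairwise (\<lambda>i j. disjnt {c i - \<eta><..<c i + \<eta>} {c j - \<eta><..<c j + \<eta>}) I"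
  shows "measure lebesgue (\<Union>i\<in>I. {c i - \<eta><..<c i + \<eta>}) = 2 * \<eta> * card I"
proof -
  have "measure lebesgue (\<Union>i\<in>I. {c i - \<eta><..<c i + \<eta>})
      = (\<Sum>i\<in>I. measure lebesgue {c i - \<eta><..<c i + \<eta>})"
    using assms by (intro measure_UNION') (auto intro: bounded_set_imp_lmeasurable)
  also have "\<dots> = 2 * \<eta> * card I"
    using assms(2) by (simp add: length_Ioo)
  finally show ?thesis .
qed

lemma parallel_set_compact:
  fixes F :: "real set"
  assumes "compact F" "F \<noteq> {}"
  shows "compact (parallel_set F \<epsilon>)"
proof -
  have "compact {x. infdist x F \<le> max \<epsilon> 1}"
    using compact_infdist_le[OF assms(2,1)] by simp
  moreover have "closed (parallel_set F \<epsilon>)"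
    unfolding parallel_set_def by (intro closed_Collect_le continuous_intros)
  moreover have "parallel_set F \<epsilon> = {x. infdist x F \<le> max \<epsilon> 1} \<inter> parallel_set F \<epsilon>"
    by (auto simp: parallel_set_def)
  ultimately show ?thesis by (metis compact_Int_closed)
qed

lemma parallel_volume_mono:
  fixes F :: "real set"
  assumes "compact F" "F \<noteq> {}" "\<delta> \<le> \<epsilon>"
  shows "parallel_volume F \<delta> \<le> parallel_volume F \<epsilon>"
  unfolding parallel_volume_def
  using parallel_set_compact[OF assms(1,2)] assms(3)
  by (intro measure_mono_fmeasurable) (auto simp: parallel_set_def lmeasurable_compact intro: fmeasurableD)

lemma parallel_volume_diff:
  fixes F :: "real set"
  assumes "compact F" "F \<noteq> {}" "\<delta> \<le> \<epsilon>"
  shows "{x. \<delta> < infdist x F \<and> infdist x F \<le> \<epsilon>} \<in> lmeasurable"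
    and "measure lebesgue {x. \<delta> < infdist x F \<and> infdist x F \<le> \<epsilon>}
       = parallel_volume F \<epsilon> - parallel_volume F \<delta>"
proof -
  have eq: "{x. \<delta> < infdist x F \<and> infdist x F \<le> \<epsilon>} = parallel_set F \<epsilon> - parallel_set F \<delta>"
    by (auto simp: parallel_set_def)
  have m: "parallel_set F a \<in> lmeasurable" for a
    by (rule lmeasurable_compact[OF parallel_set_compact[OF assms(1,2)]])
  show "{x. \<delta> < infdist x F \<and> infdist x F \<le> \<epsilon>} \<in> lmeasurable"
    unfolding eq using m by (intro fmeasurable.Diff)
  show "measure lebesgue {x. \<delta> < infdist x F \<and> infdist x F \<le> \<epsilon>}
       = parallel_volume F \<epsilon> - parallel_volume F \<delta>"
    unfolding eq parallel_volume_def using assms(3)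
    by (intro measurable_measure_Diff m fmeasurableD[OF m]) (auto simp: parallel_set_def)
qed

lemma infdist_geI:
  fixes x :: real
  assumes "F \<noteq> {}" "\<And>z. z \<in> F \<Longrightarrow> d \<le> \<bar>x - z\<bar>"
  shows "d \<le> infdist x F"
  using assms by (auto simp: infdist_def dist_real_def intro!: cINF_greatest)

lemma infdist_le_abs: "z \<in> F \<Longrightarrow> infdist x F \<le> \<bar>x - z\<bar>" for x :: real
  using infdist_le[of z F x] by (simp add: dist_real_def)

lemma nearest_point_left_or_right:
  fixes F :: "real set"
  assumes "compact F" "F \<noteq> {}"
  shows "x - infdist x F \<in> F \<or> x + infdist x F \<in> F"
proof -
  obtain z where "z \<in> F" "infdist x F = dist x z"
    using infdist_attains_inf[OF compact_imp_closed[OF assms(1)] assms(2)] by metis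
  then show ?thesis by (cases "z \<le> x") (auto simp: dist_real_def abs_if split: if_splits)
qed

lemma infdist_towards_nearest:
  fixes x :: real
  assumes "F \<noteq> {}" "\<bar>s\<bar> = 1" "x + s * infdist x F \<in> F" "0 \<le> \<eta>" "\<eta> \<le> infdist x F"
  shows "infdist (x + s * \<eta>) F = infdist x F - \<eta>"
proof (rule antisym)
  have s: "s = 1 \<or> s = -1" using assms(2) by auto
  show "infdist (x + s * \<eta>) F \<le> infdist x F - \<eta>"
    using infdist_le_abs[OF assms(3), of "x + s * \<eta>"] s assms(5) by auto
  have "infdist x F - \<eta> \<le> \<bar>(x + s * \<eta>) - z\<bar>" if "z \<in> F" for z
    using infdist_le_abs[OF that, of x] s assms(4) by auto
  then show "infdist x F - \<eta> \<le> infdist (x + s * \<eta>) F"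
    by (intro infdist_geI assms(1))
qed

lemma infdist_near_gap_centre:
  assumes "gap F m \<epsilon>" "\<bar>x - m\<bar> < \<eta>" "\<eta> \<le> \<epsilon>"
  shows "\<epsilon> - \<eta> < infdist x F" "infdist x F \<le> \<epsilon>"
proof -
  have F: "m - \<epsilon> \<in> F" "m + \<epsilon> \<in> F" using assms(1) by (auto simp: gap_def)
  show "infdist x F \<le> \<epsilon>"
    using infdist_le_abs[OF F(1), of x] infdist_le_abs[OF F(2), of x] assms(2,3) by linarith
  have "\<epsilon> - \<bar>x - m\<bar> \<le> infdist x F"
    using gap_avoids[OF assms(1)] F by (intro infdist_geI) fastforce+
  then show "\<epsilon> - \<eta> < infdist x F" using assms(2) by linarith
qed

text \<open>The parallel volume is concave with a kink at half the length of every gap. To see both at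
  once, push every point at distance between \<open>\<epsilon>\<close> and \<open>\<epsilon> + \<eta>\<close> by \<open>\<eta>\<close> towards its nearest point
  of \<open>F\<close>. Points pushed left and points pushed right do not collide, and none of them lands
  in a gap of length \<open>2 * \<epsilon>\<close>, whose points are never further than \<open>\<epsilon>\<close> from \<open>F\<close>. So the layer
  between \<open>\<epsilon> - \<eta>\<close> and \<open>\<epsilon>\<close> has room left for an interval of length \<open>2 * \<eta>\<close> around the centre of each
  gap of length \<open>2 * \<epsilon>\<close>.\<close>

lemma parallel_volume_kink:
  fixes F :: "real set"
  assumes F: "compact F" "F \<noteq> {}" and \<eta>: "0 < \<eta>" "\<eta> \<le> \<epsilon>"
    and M: "finite M" "\<And>m. m \<in> M \<Longrightarrow> gap F m \<epsilon>"
  shows "parallel_volume F (\<epsilon> + \<eta>) + parallel_volume F (\<epsilon> - \<eta>) + 2 * \<eta> * card M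
       \<le> 2 * parallel_volume F \<epsilon>"
proof -
  define d where "d x = infdist x F" for x
  define A where "A = {x. \<epsilon> < d x \<and> d x \<le> \<epsilon> + \<eta>}"
  define C where "C = {x. \<epsilon> - \<eta> < d x \<and> d x \<le> \<epsilon>}"
  define L where "L = A \<inter> {x. x - d x \<in> F}"
  define R where "R = A \<inter> {x. x + d x \<in> F}"
  define S where "S = (\<Union>m\<in>M. {m - \<eta><..<m + \<eta>})"
  have A: "A \<in> lmeasurable" "measure lebesgue A = parallel_volume F (\<epsilon> + \<eta>) - parallel_volume F \<epsilon>"
    unfolding A_def d_def using parallel_volume_diff[OF F, of \<epsilon> "\<epsilon> + \<eta>"] \<eta> by auto
  have C: "C \<in> lmeasurable" "measure lebesgue C = parallel_volume F \<epsilon> - parallel_volume F (\<epsilon> - \<eta>)"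
    unfolding C_def d_def using parallel_volume_diff[OF F, of "\<epsilon> - \<eta>" \<epsilon>] \<eta> by auto
  have cl: "closed {x. x - d x \<in> F}" "closed {x. x + d x \<in> F}"
  proof -
    have "closed ((\<lambda>x. x - d x) -` F)" "closed ((\<lambda>x. x + d x) -` F)"
      unfolding d_def by (intro continuous_closed_vimage compact_imp_closed F continuous_intros)+
    then show "closed {x. x - d x \<in> F}" "closed {x. x + d x \<in> F}"
      by (simp_all add: vimage_def)
  qed
  have L: "L \<in> lmeasurable" and R: "R \<in> lmeasurable"
    unfolding L_def R_def using A(1) cl
    by (auto intro!: fmeasurable_Int_fmeasurable)
  have ALR: "A = L \<union> R"
    unfolding L_def R_def d_def using nearest_point_left_or_right[OF F] by blast
  have disj_S: "pairwise (\<lambda>i j. disjnt {i - \<eta><..<i + \<eta>} {j - \<eta><..<j + \<eta>}) M"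
  proof -
    have *: "m + \<eta> \<le> m' - \<eta>" if "m \<in> M" "m' \<in> M" "m < m'" for m m'
    proof -
      have "m' - \<epsilon> \<in> F" using M(2)[OF that(2)] by (simp add: gap_def)
      from gap_avoids[OF M(2)[OF that(1)] this] show ?thesis using that \<eta> by linarith
    qed
    show ?thesis
    proof (rule pairwiseI)
      fix m m' assume "m \<in> M" "m' \<in> M" "m \<noteq> m'"
      then show "disjnt {m - \<eta><..<m + \<eta>} {m' - \<eta><..<m' + \<eta>}"
        using *[of m m'] *[of m' m] by (cases "m < m'") (auto simp: disjnt_def)
    qed
  qed
  have S: "S \<in> lmeasurable" "measure lebesgue S = 2 * \<eta> * card M"
    unfolding S_def using M(1) disj_S \<eta>
    by (auto intro!: fmeasurable.finite_UN bounded_set_imp_lmeasurable measure_disjoint_Ioo_union[where c="\<lambda>x. x"])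
  let ?L = "(\<lambda>x. x - \<eta>) ` L" and ?R = "(+) \<eta> ` R"
  have mL: "?L \<in> lmeasurable" "measure lebesgue ?L = measure lebesgue L"
    using L by (auto simp: measurable_translation_subtract measure_translation_subtract)
  have mR: "?R \<in> lmeasurable" "measure lebesgue ?R = measure lebesgue R"
    using R by (auto simp: measurable_translation measure_translation)
  have pL: "d (x - \<eta>) = d x - \<eta>" "x - d x \<in> F" "\<epsilon> < d x" "d x \<le> \<epsilon> + \<eta>" if "x \<in> L" for x
    using infdist_towards_nearest[of F "-1" x \<eta>] F(2) \<eta> that by (auto simp: L_def A_def d_def)
  have pR: "d (x + \<eta>) = d x - \<eta>" "x + d x \<in> F" "\<epsilon> < d x" "d x \<le> \<epsilon> + \<eta>" if "x \<in> R" for x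
    using infdist_towards_nearest[of F "1" x \<eta>] F(2) \<eta> that by (auto simp: R_def A_def d_def)
  have dle: "d x \<le> \<bar>x - z\<bar>" if "z \<in> F" for x z
    unfolding d_def using infdist_le_abs[OF that] .
  have "?L \<union> ?R \<union> S \<subseteq> C"
  proof -
    have "x \<in> C" if "x \<in> S" for x
      using that \<eta> infdist_near_gap_centre[OF M(2), of _ x \<eta>]
      by (auto simp: S_def C_def d_def abs_less_iff)
    moreover have "x - \<eta> \<in> C" if "x \<in> L" for x
      using pL[OF that] \<eta> by (simp add: C_def)
    moreover have "\<eta> + x \<in> C" if "x \<in> R" for x
      using pR[OF that] \<eta> by (simp add: C_def add.commute)
    ultimately show ?thesis by blast
  qed
  moreover have "?L \<inter> ?R = {}"
  proof -
    have False if x: "x \<in> L" and y: "y \<in> R" and e: "x - \<eta> = y + \<eta>" for x y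
    proof -
      have "d x = d y" using pL(1)[OF x] pR(1)[OF y] e by simp
      then show False using dle[OF pR(2)[OF y], of x] pR(3)[OF y] e \<eta> by linarith
    qed
    then show ?thesis by (force simp: add.commute)
  qed
  moreover have "?L \<inter> S = {}" "?R \<inter> S = {}"
  proof -
    have False if x: "x \<in> L" and m: "m \<in> M" "\<bar>x - \<eta> - m\<bar> < \<eta>" for x m
    proof -
      have mF: "m - \<epsilon> \<in> F" "m + \<epsilon> \<in> F" using M(2)[OF m(1)] by (auto simp: gap_def)
      \<comment> \<open>The nearest point of \<open>x\<close> would be the left end of the gap, and \<open>x\<close> would be too deep in the gap.\<close>
      show False
        using gap_avoids[OF M(2)[OF m(1)] pL(2)[OF x]] dle[OF mF(1), of x] dle[OF mF(2), of x]
          pL(3,4)[OF x] m(2) \<eta> by linarith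
    qed
    then show "?L \<inter> S = {}" by (force simp: S_def abs_less_iff)
    have False if x: "x \<in> R" and m: "m \<in> M" "\<bar>x + \<eta> - m\<bar> < \<eta>" for x m
    proof -
      have mF: "m - \<epsilon> \<in> F" "m + \<epsilon> \<in> F" using M(2)[OF m(1)] by (auto simp: gap_def)
      show False
        using gap_avoids[OF M(2)[OF m(1)] pR(2)[OF x]] dle[OF mF(1), of x] dle[OF mF(2), of x]
          pR(3,4)[OF x] m(2) \<eta> by linarith
    qed
    then show "?R \<inter> S = {}" by (force simp: S_def abs_less_iff)
  qed
  ultimately have sub: "?L \<union> ?R \<union> S \<subseteq> C" and disj: "?R - ?L = ?R" "S - (?L \<union> ?R) = S"
    by blast+
  have "measure lebesgue (?L \<union> ?R \<union> S)
      = measure lebesgue ?L + measure lebesgue ?R + measure lebesgue S"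
    using measure_Un2[OF fmeasurable.Un[OF mL(1) mR(1)] S(1)] measure_Un2[OF mL(1) mR(1)] disj
    by simp
  moreover have "measure lebesgue (?L \<union> ?R \<union> S) \<le> measure lebesgue C"
    using sub mL(1) mR(1) S(1) C(1)
    by (intro measure_mono_fmeasurable fmeasurableD fmeasurable.Un)
  moreover have "measure lebesgue A \<le> measure lebesgue L + measure lebesgue R"
    unfolding ALR using L R by (intro measure_Un_le) auto
  ultimately show ?thesis using A(2) C(2) S(2) mL(2) mR(2) by linarith
qed

text \<open>A parallel volume asymptotic to a multiple of \<open>\<epsilon> powr p\<close> cannot have such kinks of comparable
  size at arbitrarily small scales: after rescaling, the second difference of
  \<open>x powr p\<close> at \<open>1\<close> would be at most a fixed negative multiple of the step size, whereas for a
  function differentiable at \<open>1\<close> it is of smaller order than the step size.\<close>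

lemma no_kinks_in_power_asymptotics:
  fixes V :: "real \<Rightarrow> real"
  assumes lim: "((\<lambda>\<epsilon>. \<epsilon> powr (- p) * V \<epsilon>) \<longlongrightarrow> M) (at_right 0)" and M: "0 < M"
    and c: "0 < c" "0 < a"
    and eps: "e \<longlonglongrightarrow> 0" "\<And>n. 0 < e n"
    and kink: "\<And>n h. 0 < h \<Longrightarrow> h < 1 \<Longrightarrow>
       V (e n * (1 + h)) + V (e n * (1 - h)) + c * h * V (e n * a) \<le> 2 * V (e n)"
  shows False
proof -
  have scaled: "(\<lambda>n. e n powr (- p) * V (e n * x)) \<longlonglongrightarrow> M * x powr p" if x: "0 < x" for x
  proof -
    have "filterlim (\<lambda>n. e n * x) (at_right 0) sequentially"
      using eps x tendsto_mult[OF eps(1) tendsto_const[of x]]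
      by (auto simp: filterlim_at less_imp_neq[OF eps(2), symmetric] intro!: always_eventually)
    from filterlim_compose[OF lim this]
    have "(\<lambda>n. (e n * x) powr (- p) * V (e n * x)) \<longlonglongrightarrow> M" .
    from tendsto_mult[OF this tendsto_const[of "x powr p"]]
    have "(\<lambda>n. (e n * x) powr (- p) * V (e n * x) * x powr p) \<longlonglongrightarrow> M * x powr p" .
    moreover have "(e n * x) powr (- p) * V (e n * x) * x powr p = e n powr (- p) * V (e n * x)" for n
      using x eps(2)[of n] by (simp add: powr_mult powr_minus field_simps less_imp_le)
    ultimately show ?thesis by simp
  qed
  have ineq: "(1 + h) powr p + (1 - h) powr p + c * a powr p * h \<le> 2" if h: "0 < h" "h < 1" for h
  proof -
    have "(\<lambda>n. e n powr (- p) * V (e n * (1 + h)) + e n powr (- p) * V (e n * (1 - h))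
            + c * h * (e n powr (- p) * V (e n * a)))
        \<longlonglongrightarrow> M * (1 + h) powr p + M * (1 - h) powr p + c * h * (M * a powr p)"
      using h c by (intro tendsto_intros scaled) auto
    moreover have "(\<lambda>n. 2 * (e n powr (- p) * V (e n * 1))) \<longlonglongrightarrow> 2 * (M * 1 powr p)"
      by (intro tendsto_intros scaled) auto
    moreover have "\<exists>n0. \<forall>n\<ge>n0. e n powr (- p) * V (e n * (1 + h)) + e n powr (- p) * V (e n * (1 - h))
            + c * h * (e n powr (- p) * V (e n * a)) \<le> 2 * (e n powr (- p) * V (e n * 1))"
    proof (intro exI allI impI)
      fix n
      show "e n powr (- p) * V (e n * (1 + h)) + e n powr (- p) * V (e n * (1 - h))
            + c * h * (e n powr (- p) * V (e n * a)) \<le> 2 * (e n powr (- p) * V (e n * 1))"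
        using mult_left_mono[OF kink[OF h, of n], of "e n powr (- p)"] by (simp add: algebra_simps)
    qed
    ultimately have "M * (1 + h) powr p + M * (1 - h) powr p + c * h * (M * a powr p)
        \<le> 2 * (M * 1 powr p)"
      by (rule LIMSEQ_le)
    then have "M * ((1 + h) powr p + (1 - h) powr p + c * a powr p * h) \<le> M * 2"
      by (simp add: algebra_simps)
    then show ?thesis using M by simp
  qed
  \<comment> \<open>The first two terms have opposite slopes at \<open>0\<close>, so the third one makes \<open>g\<close> increase from \<open>g 0 = 2\<close>.\<close>
  define g where "g h = (1 + h) powr p + (1 - h) powr p + c * a powr p * h" for h
  have "(g has_real_derivative (p * 1 powr (p - 1) - p * 1 powr (p - 1) + c * a powr p)) (at 0)"
    unfolding g_def by (auto intro!: derivative_eq_intros)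
  then have "DERIV g 0 :> c * a powr p" by simp
  from DERIV_pos_inc_right[OF this] c
  obtain d where d: "d > 0" "\<And>h. h > 0 \<Longrightarrow> h < d \<Longrightarrow> g 0 < g (0 + h)" by auto
  define h where "h = min d 1 / 2"
  have h: "0 < h" "h < d" "h < 1" using d(1) by (auto simp: h_def)
  from d(2)[OF h(1,2)] ineq[OF h(1,3)] show False by (simp add: g_def)
qed

section \<open>Words and stopping sets\<close>

fun word_map :: "(nat \<Rightarrow> real \<Rightarrow> real) \<Rightarrow> nat list \<Rightarrow> real \<Rightarrow> real" where
  "word_map \<phi> [] = id"
| "word_map \<phi> (i # w) = \<phi> i \<circ> word_map \<phi> w"

lemma word_map_append: "word_map \<phi> (v @ w) = word_map \<phi> v \<circ> word_map \<phi> w"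
  by (induction v) (auto simp: comp_assoc)

lemma real_similarity_affine:
  fixes f :: "real \<Rightarrow> real"
  assumes "0 < \<rho>" "\<And>x y. \<bar>f x - f y\<bar> = \<rho> * \<bar>x - y\<bar>"
  shows "\<exists>s. \<bar>s\<bar> = \<rho> \<and> (\<forall>x. f x = f 0 + s * x)"
proof (intro exI conjI allI)
  define s where "s = f 1 - f 0"
  show s: "\<bar>f 1 - f 0\<bar> = \<rho>" using assms(2)[of 1 0] by simp
  fix x
  have s0: "s \<noteq> 0" using s assms(1) by (auto simp: s_def)
  define y where "y = (f x - f 0) / s"
  have fx: "f x = f 0 + s * y" using s0 by (simp add: y_def)
  have "\<rho> * \<bar>y\<bar> = \<rho> * \<bar>x\<bar>"
    using assms(2)[of x 0] s by (simp add: fx s_def abs_mult)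
  \<comment> \<open>Equal distances to both \<open>0\<close> and \<open>1\<close> identify a real number.\<close>
  then have 1: "y\<^sup>2 = x\<^sup>2" using assms(1) by (simp add: abs_eq_iff power2_eq_iff)
  have "f x - f 1 = s * (y - 1)" by (simp add: fx s_def algebra_simps)
  then have "\<rho> * \<bar>y - 1\<bar> = \<rho> * \<bar>x - 1\<bar>"
    using assms(2)[of x 1] s by (simp add: s_def abs_mult)
  then have 2: "(y - 1)\<^sup>2 = (x - 1)\<^sup>2" using assms(1) by (metis mult_cancel_left less_irrefl power2_abs)
  have "y = x" using 1 2 by (simp add: power2_diff)
  then show "f x = f 0 + (f 1 - f 0) * x" using fx by (simp add: s_def)
qed

locale self_similar_osc =
  fixes N :: nat and \<phi> :: "nat \<Rightarrow> real \<Rightarrow> real" and r :: "nat \<Rightarrow> real" and F :: "real set"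
  assumes ifs: "similarity_ifs N \<phi> r"
    and osc: "open_set_condition N \<phi>"
    and self_similar: "self_similar_set N \<phi> F"
begin

abbreviation words :: "nat list set" where "words \<equiv> lists {1..N}"

abbreviation f :: "nat list \<Rightarrow> real \<Rightarrow> real" where "f \<equiv> word_map \<phi>"

definition ratio :: "nat list \<Rightarrow> real" where "ratio w = prod_list (map r w)"

lemma ratio_simps [simp]:
  "ratio [] = 1" "ratio (i # w) = r i * ratio w" "ratio (v @ w) = ratio v * ratio w"
  by (simp_all add: ratio_def)

lemma compact_F: "compact F" and F_nonempty: "F \<noteq> {}"
  using self_similar by (auto simp: self_similar_set_def)

lemma letter_ratio: "i \<in> {1..N} \<Longrightarrow> 0 < r i \<and> r i < 1"
  using ifs by (auto simp: similarity_ifs_def contracting_similarity_def)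

lemma letter_dist: "i \<in> {1..N} \<Longrightarrow> \<bar>\<phi> i x - \<phi> i y\<bar> = r i * \<bar>x - y\<bar>"
  using ifs by (auto simp: similarity_ifs_def contracting_similarity_def dist_real_def)

lemma ratio_bounds: "w \<in> words \<Longrightarrow> 0 < ratio w \<and> ratio w \<le> 1"
proof (induction w)
  case (Cons i w)
  then show ?case using letter_ratio[of i] by (auto intro: mult_le_one)
qed simp

lemma ratio_less_1: "w \<in> words \<Longrightarrow> w \<noteq> [] \<Longrightarrow> ratio w < 1"
proof (cases w)
  case (Cons i v)
  assume "w \<in> words"
  then have "0 < r i" "r i < 1" "0 < ratio v" "ratio v \<le> 1"
    using Cons letter_ratio[of i] ratio_bounds[of v] by auto
  moreover from this have "r i * ratio v \<le> r i * 1" by (intro mult_left_mono) auto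
  ultimately show ?thesis unfolding Cons ratio_simps by linarith
qed simp

lemma f_dist: "w \<in> words \<Longrightarrow> \<bar>f w x - f w y\<bar> = ratio w * \<bar>x - y\<bar>"
  by (induction w arbitrary: x y) (auto simp: letter_dist)

lemma f_affine:
  assumes "w \<in> words"
  obtains s where "\<bar>s\<bar> = ratio w" "\<And>x. f w x = f w 0 + s * x"
  using real_similarity_affine[of "ratio w" "f w"] f_dist[OF assms] ratio_bounds[OF assms] by metis

lemma f_surj:
  assumes "w \<in> words"
  obtains x where "y = f w x"
proof -
  obtain s where s: "\<bar>s\<bar> = ratio w" "\<And>x. f w x = f w 0 + s * x" by (rule f_affine[OF assms]) blast
  have "s \<noteq> 0" using s(1) ratio_bounds[OF assms] by auto
  then have "y = f w ((y - f w 0) / s)" by (subst s(2)) simp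
  then show ?thesis using that by blast
qed

lemma f_invariant:
  assumes "\<And>i. i \<in> {1..N} \<Longrightarrow> \<phi> i ` A \<subseteq> A" "w \<in> words"
  shows "f w ` A \<subseteq> A"
  using assms(2) by (induction w) (use assms(1) in \<open>auto simp: image_subset_iff\<close>)

lemma f_in_F: "w \<in> words \<Longrightarrow> x \<in> F \<Longrightarrow> f w x \<in> F"
  using f_invariant[of F w] self_similar unfolding self_similar_set_def by blast

lemma feasible_open_set:
  obtains U where "open U" "U \<noteq> {}" "\<And>i. i \<in> {1..N} \<Longrightarrow> \<phi> i ` U \<subseteq> U"
    "\<And>i j. i \<in> {1..N} \<Longrightarrow> j \<in> {1..N} \<Longrightarrow> i \<noteq> j \<Longrightarrow> \<phi> i ` U \<inter> \<phi> j ` U = {}"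
proof -
  obtain U where "open U" "U \<noteq> {}" "\<forall>i\<in>{1..N}. \<phi> i ` U \<subseteq> U"
      "\<forall>i\<in>{1..N}. \<forall>j\<in>{1..N}. i \<noteq> j \<longrightarrow> \<phi> i ` U \<inter> \<phi> j ` U = {}"
    using osc unfolding open_set_condition_def by (elim exE conjE)
  then show thesis by (intro that[of U]) simp_all
qed

lemma letter_preimage:
  assumes "x \<in> F"
  obtains i y where "i \<in> {1..N}" "y \<in> F" "x = \<phi> i y"
  using self_similar assms unfolding self_similar_set_def by blast

text \<open>The words at which the ratio first drops to \<open>t\<close> or below: the pieces \<open>f w ` F\<close> are then all of
  size comparable to \<open>t\<close>.\<close>

definition cut :: "real \<Rightarrow> nat list set" where
  "cut t = {w \<in> words. w \<noteq> [] \<and> ratio w \<le> t \<and> t < ratio (butlast w)}"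

lemma cutD: "w \<in> cut t \<Longrightarrow> w \<in> words \<and> ratio w \<le> t"
  by (simp add: cut_def)

lemma cut_covers:
  assumes "x \<in> F" "0 < t" "t < 1"
  obtains w y where "w \<in> cut t" "y \<in> F" "x = f w y"
proof -
  have fin: "finite (r ` {1..N})" "r ` {1..N} \<noteq> {}"
    using ifs by (auto simp: similarity_ifs_def)
  define q where "q = Max (r ` {1..N})"
  have q: "r i \<le> q" if "i \<in> {1..N}" for i
    using that fin by (simp add: q_def)
  have q01: "0 < q" "q < 1"
    using Max_in[OF fin] letter_ratio by (auto simp: q_def)
  \<comment> \<open>Descend along an address of \<open>x\<close>; the number \<open>n\<close> bounds the letters that are still needed.\<close>
  have *: "\<exists>w\<in>cut t. \<exists>y\<in>F. x = f w y" if "x \<in> F" "0 < t" "t < 1" "q ^ n \<le> t" for n x t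
    using that
  proof (induction n arbitrary: x t)
    case (Suc n)
    obtain i y where i: "i \<in> {1..N}" "y \<in> F" "x = \<phi> i y" by (rule letter_preimage[OF Suc.prems(1)])
    note ri = letter_ratio[OF i(1)]
    show ?case
    proof (cases "r i \<le> t")
      case True
      then have "[i] \<in> cut t" using i(1) Suc.prems(3) by (simp add: cut_def)
      then show ?thesis using i by (intro bexI[of _ "[i]"]) auto
    next
      case False
      have "q ^ n \<le> t / q" using Suc.prems(4) q01 by (simp add: field_simps)
      also have "\<dots> \<le> t / r i" using q[OF i(1)] ri Suc.prems(2) by (intro divide_left_mono) auto
      finally have "\<exists>w\<in>cut (t / r i). \<exists>z\<in>F. y = f w z"
        using False ri Suc.prems(2) i(2) by (intro Suc.IH) auto
      then obtain w z where w: "w \<in> cut (t / r i)" "z \<in> F" "y = f w z" by blast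
      then have "i # w \<in> cut t" using i(1) ri by (auto simp: cut_def field_simps)
      then show ?thesis using i w by (intro bexI[of _ "i # w"]) auto
    qed
  qed simp
  obtain n where "q ^ n < t" using real_arch_pow_inv[OF assms(2) q01(2)] by blast
  with *[OF assms, of n] that show ?thesis by auto
qed

lemma cut_ratio_lower_bound:
  obtains c where "0 < c" "\<And>t w. 0 < t \<Longrightarrow> w \<in> cut t \<Longrightarrow> c * t < ratio w"
proof -
  have fin: "finite (r ` {1..N})" "r ` {1..N} \<noteq> {}"
    using ifs by (auto simp: similarity_ifs_def)
  define c where "c = Min (r ` {1..N})"
  have c: "c \<le> r i" if "i \<in> {1..N}" for i
    using that fin by (simp add: c_def)
  have c0: "0 < c" using Min_in[OF fin] letter_ratio by (auto simp: c_def)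
  have "c * t < ratio w" if t: "0 < t" and w: "w \<in> cut t" for t w
  proof -
    have *: "w \<noteq> []" "w \<in> words" "t < ratio (butlast w)" using w by (auto simp: cut_def)
    have "ratio w = ratio (butlast w) * r (last w)"
      using arg_cong[OF append_butlast_last_id[OF *(1)], of ratio] by simp
    moreover have "last w \<in> {1..N}" using *(1,2) last_in_set by (metis in_listsD)
    note c[OF this]
    ultimately show ?thesis using *(3) c0 t
      by (metis mult.commute mult_le_less_imp_less less_imp_le)
  qed
  then show ?thesis using that c0 by blast
qed

lemma append_cut: "w \<in> words \<Longrightarrow> v \<in> cut t \<Longrightarrow> w @ v \<in> cut (ratio w * t)"
  using ratio_bounds[of w] by (auto simp: cut_def butlast_append)

lemma incomparable_images_disjoint:
  assumes U: "\<And>i. i \<in> {1..N} \<Longrightarrow> \<phi> i ` U \<subseteq> U"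
    and disj: "\<And>i j. i \<in> {1..N} \<Longrightarrow> j \<in> {1..N} \<Longrightarrow> i \<noteq> j \<Longrightarrow> \<phi> i ` U \<inter> \<phi> j ` U = {}"
    and v: "v \<in> words" and w: "w \<in> words" and ext: "\<And>u. w \<noteq> v @ u" "\<And>u. v \<noteq> w @ u"
  shows "f v ` U \<inter> f w ` U = {}"
  using v w ext
proof (induction v arbitrary: w rule: list.induct)
  case (Cons i v)
  note no_ext = Cons.prems(3,4)
  obtain j w' where w: "w = j # w'" using no_ext(2)[of "i # v"] by (cases w) auto
  have sub: "f v ` U \<subseteq> U" "f w' ` U \<subseteq> U"
    using f_invariant[OF U, of v] f_invariant[OF U, of w'] Cons.prems(1,2) w by simp_all
  show ?case
  proof (cases "i = j")
    case False
    then have "\<phi> i ` U \<inter> \<phi> j ` U = {}" using Cons.prems w by (intro disj) auto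
    moreover have "f (i # v) ` U \<subseteq> \<phi> i ` U" "f w ` U \<subseteq> \<phi> j ` U"
      using image_mono[OF sub(1), of "\<phi> i"] image_mono[OF sub(2), of "\<phi> j"]
      by (simp_all add: w image_comp)
    ultimately show ?thesis by blast
  next
    case True
    have "f v ` U \<inter> f w' ` U = {}" using Cons.prems w True by (intro Cons.IH) auto
    moreover have "inj (\<phi> i)"
      using letter_dist[of i] letter_ratio[of i] Cons.prems(1)
      by (auto intro!: injI) (metis abs_eq_0 diff_self eq_iff_diff_eq_0 mult_eq_0_iff less_irrefl)
    ultimately show ?thesis unfolding w True by (auto simp: inj_eq)
  qed
next
  case Nil
  from Nil.prems(3)[of w] show ?case by simp
qed

lemma cut_incomparable:
  assumes "v \<in> cut t" "w \<in> cut t" "v \<noteq> w"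
  shows "w \<noteq> v @ u"
proof
  assume w: "w = v @ u"
  then have u: "u \<noteq> []" using assms(3) by auto
  have "set u \<subseteq> {1..N}" using w assms(2) by (auto simp: cut_def)
  then have "butlast u \<in> words" by (auto dest: in_set_butlastD)
  then have "ratio (butlast w) \<le> ratio v"
    using ratio_bounds[of "butlast u"] ratio_bounds[of v] assms(1) u w
    by (simp add: butlast_append cut_def mult_left_le)
  then show False using assms(1,2) by (simp add: cut_def)
qed

text \<open>A volume count: the disjoint images of the open set under the maps of one stopping set contain
  intervals of length comparable to \<open>t\<close>, so only boundedly many of them fit near a point.\<close>

lemma bounded_multiplicity:
  assumes L: "0 \<le> L"
  obtains B :: nat where
    "\<And>t z. 0 < t \<Longrightarrow> finite {w \<in> cut t. \<exists>x\<in>F. \<bar>f w x - z\<bar> \<le> L * t} \<and>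
       card {w \<in> cut t. \<exists>x\<in>F. \<bar>f w x - z\<bar> \<le> L * t} \<le> B"
proof -
  obtain U where U: "open U" "U \<noteq> {}" "\<And>i. i \<in> {1..N} \<Longrightarrow> \<phi> i ` U \<subseteq> U"
      "\<And>i j. i \<in> {1..N} \<Longrightarrow> j \<in> {1..N} \<Longrightarrow> i \<noteq> j \<Longrightarrow> \<phi> i ` U \<inter> \<phi> j ` U = {}"
    by (rule feasible_open_set) (rule that; simp)
  obtain a \<delta> where a: "0 < \<delta>" "\<And>x. \<bar>x - a\<bar> < \<delta> \<Longrightarrow> x \<in> U"
    using U(1,2) unfolding open_dist dist_real_def by blast
  obtain R where R: "\<And>x. x \<in> F \<Longrightarrow> \<bar>x - a\<bar> \<le> R"
    using compact_imp_bounded[OF compact_F] unfolding bounded_any_center[where a=a]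
    by (metis dist_commute dist_real_def)
  then have R0: "0 \<le> R" using F_nonempty by force
  obtain c where c: "0 < c" "\<And>t w. 0 < t \<Longrightarrow> w \<in> cut t \<Longrightarrow> c * t < ratio w"
    by (rule cut_ratio_lower_bound) blast
  define B where "B = nat \<lfloor>(L + R + \<delta> * c) / (\<delta> * c)\<rfloor>"
  have bound: "card G \<le> B"
    if t: "0 < t" and G: "G \<subseteq> {w \<in> cut t. \<exists>x\<in>F. \<bar>f w x - z\<bar> \<le> L * t}" "finite G" for t z G
  proof -
    define \<eta> where "\<eta> = \<delta> * c * t"
    have \<eta>: "0 < \<eta>" using a c t by (simp add: \<eta>_def)
    define I where "I w = {f w a - \<eta><..<f w a + \<eta>}" for w
    have sub_U: "I w \<subseteq> f w ` U" if "w \<in> G" for w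
    proof
      fix y assume y: "y \<in> I w"
      have w: "w \<in> words" "w \<in> cut t" using that G by (auto simp: cut_def)
      obtain x where x: "y = f w x" by (rule f_surj[OF w(1)])
      have "ratio w * \<bar>x - a\<bar> < \<delta> * (c * t)"
        using y unfolding f_dist[OF w(1), symmetric] x[symmetric] by (auto simp: I_def \<eta>_def mult.assoc)
      also have "\<dots> < \<delta> * ratio w" using c(2)[OF t w(2)] a(1) by simp
      finally have "\<bar>x - a\<bar> < \<delta>" using ratio_bounds[OF w(1)] by (simp add: mult.commute)
      then show "y \<in> f w ` U" using a(2) x by blast
    qed
    have "pairwise (\<lambda>v w. disjnt (I v) (I w)) G"
    proof (rule pairwiseI)
      fix v w assume vw: "v \<in> G" "w \<in> G" "v \<noteq> w"
      then have cut: "v \<in> cut t" "w \<in> cut t" using G by auto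
      have "f v ` U \<inter> f w ` U = {}"
        using cutD[OF cut(1)] cutD[OF cut(2)] cut_incomparable[OF cut vw(3)]
          cut_incomparable[OF cut(2,1) vw(3)[symmetric]]
        by (intro incomparable_images_disjoint[OF U(3,4)]) auto
      then show "disjnt (I v) (I w)" using sub_U[OF vw(1)] sub_U[OF vw(2)] by (auto simp: disjnt_def)
    qed
    then have "2 * \<eta> * card G = measure lebesgue (\<Union>w\<in>G. I w)"
      unfolding I_def using measure_disjoint_Ioo_union[OF G(2), of \<eta> "\<lambda>w. f w a"] \<eta> by simp
    also have "\<dots> \<le> measure lebesgue {z - (L + R + \<delta> * c) * t<..<z + (L + R + \<delta> * c) * t}"
    proof (rule measure_mono_fmeasurable)
      have "\<bar>f w a - z\<bar> \<le> (L + R) * t" if w: "w \<in> G" for w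
      proof -
        obtain x where x: "x \<in> F" "\<bar>f w x - z\<bar> \<le> L * t" using w G by auto
        have "w \<in> words" "ratio w \<le> t" using w G cutD by auto
        then have "\<bar>f w x - f w a\<bar> \<le> t * R"
          using R[OF x(1)] ratio_bounds[of w] t by (simp add: f_dist mult_mono)
        with x(2) show ?thesis by (simp add: algebra_simps)
      qed
      then show "(\<Union>w\<in>G. I w) \<subseteq> {z - (L + R + \<delta> * c) * t<..<z + (L + R + \<delta> * c) * t}"
        unfolding I_def \<eta>_def by (fastforce simp: algebra_simps)
    qed (auto simp: I_def intro: bounded_set_imp_lmeasurable)
    also have "\<dots> = 2 * ((L + R + \<delta> * c) * t)"
      using L R0 a c t by (subst length_Ioo) auto
    finally have "\<eta> * card G \<le> (L + R + \<delta> * c) * t" by simp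
    then have "(\<delta> * c * card G) * t \<le> (L + R + \<delta> * c) * t" by (simp add: \<eta>_def mult.assoc mult.commute mult.left_commute)
    then have "\<delta> * c * card G \<le> L + R + \<delta> * c" using t by simp
    then have "real (card G) \<le> (L + R + \<delta> * c) / (\<delta> * c)"
      using a c by (simp add: pos_le_divide_eq mult.commute)
    then show ?thesis unfolding B_def by (simp add: le_nat_floor)
  qed
  show thesis
    by (rule that[of B]) (intro finite_if_finite_subsets_card_bdd bound)
qed

lemma F_within:
  assumes "a \<in> F"
  obtains D where "0 \<le> D" "\<And>x. x \<in> F \<Longrightarrow> \<bar>x - a\<bar> \<le> D"
proof -
  obtain D where D: "\<And>x. x \<in> F \<Longrightarrow> \<bar>x - a\<bar> \<le> D"
    using compact_imp_bounded[OF compact_F] unfolding bounded_any_center[where a=a]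
    by (metis dist_commute dist_real_def)
  then show ?thesis using that[of D] assms by force
qed

lemma finite_cut:
  assumes "0 < t"
  shows "finite (cut t)"
proof -
  obtain a where a: "a \<in> F" using F_nonempty by blast
  obtain D where D: "0 \<le> D" "\<And>x. x \<in> F \<Longrightarrow> \<bar>x - a\<bar> \<le> D" using F_within[OF a] by metis
  have "0 \<le> D / t" using D assms by simp
  then obtain B :: nat where "\<And>s z. 0 < s \<Longrightarrow> finite {w \<in> cut s. \<exists>x\<in>F. \<bar>f w x - z\<bar> \<le> D / t * s} \<and>
       card {w \<in> cut s. \<exists>x\<in>F. \<bar>f w x - z\<bar> \<le> D / t * s} \<le> B"
    by (rule bounded_multiplicity) blast
  from this[OF assms]
  have "finite {w \<in> cut t. \<exists>x\<in>F. \<bar>f w x - a\<bar> \<le> D / t * t}" by simp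
  moreover have "{w \<in> cut t. \<exists>x\<in>F. \<bar>f w x - a\<bar> \<le> D / t * t} = cut t"
    using D(2) a assms f_in_F cutD by fastforce
  ultimately show ?thesis by simp
qed

section \<open>A gap that is copied by every word\<close>

text \<open>Choose the piece \<open>f u ` F\<close> with the largest number of neighbouring pieces of its size. Passing
  to \<open>w @ u\<close> keeps all its neighbours, and by maximality it gains none, so everything of \<open>F\<close> near
  \<open>f (w @ u) ` F\<close> comes from inside \<open>f w ` F\<close>.\<close>

lemma maximal_neighbourhood_piece:
  obtains u where "u \<in> words" "u \<noteq> []"
    "\<And>w x z. w \<in> words \<Longrightarrow> x \<in> F \<Longrightarrow> z \<in> F \<Longrightarrow> \<bar>x - f w (f u z)\<bar> < ratio w * ratio u \<Longrightarrow> x \<in> f w ` F"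
proof -
  define near where
    "near u = {v \<in> cut (ratio u). \<exists>x\<in>F. \<exists>y\<in>F. \<bar>f u x - f v y\<bar> < ratio u}" for u
  obtain a where a: "a \<in> F" using F_nonempty by blast
  obtain D where D: "0 \<le> D" "\<And>x. x \<in> F \<Longrightarrow> \<bar>x - a\<bar> \<le> D" using F_within[OF a] by metis
  have "0 \<le> D + 1" using D by simp
  then obtain B :: nat where B: "\<And>t z. 0 < t \<Longrightarrow> finite {w \<in> cut t. \<exists>x\<in>F. \<bar>f w x - z\<bar> \<le> (D + 1) * t} \<and>
       card {w \<in> cut t. \<exists>x\<in>F. \<bar>f w x - z\<bar> \<le> (D + 1) * t} \<le> B"
    by (rule bounded_multiplicity) blast
  have near_bound: "finite (near u) \<and> card (near u) \<le> B" if u: "u \<in> words" for u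
  proof -
    have sub: "near u \<subseteq> {w \<in> cut (ratio u). \<exists>x\<in>F. \<bar>f w x - f u a\<bar> \<le> (D + 1) * ratio u}"
    proof
      fix v assume "v \<in> near u"
      then obtain x y where v: "v \<in> cut (ratio u)" "x \<in> F" "y \<in> F" "\<bar>f u x - f v y\<bar> < ratio u"
        by (auto simp: near_def)
      have "\<bar>f u x - f u a\<bar> \<le> ratio u * D"
        using D(2)[OF v(2)] ratio_bounds[OF u] by (simp add: f_dist[OF u])
      then have "\<bar>f v y - f u a\<bar> \<le> (D + 1) * ratio u" using v(4) by (simp add: algebra_simps)
      then show "v \<in> {w \<in> cut (ratio u). \<exists>x\<in>F. \<bar>f w x - f u a\<bar> \<le> (D + 1) * ratio u}"
        using v by blast
    qed
    have "0 < ratio u" using ratio_bounds[OF u] by simp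
    note B' = B[OF this, of "f u a"]
    show ?thesis
      using finite_subset[OF sub] card_mono[OF _ sub] B' by linarith
  qed
  have "[1] \<in> words \<and> [1::nat] \<noteq> []" using ifs by (simp add: similarity_ifs_def)
  then obtain u where u: "u \<in> words" "u \<noteq> []"
      and max: "\<And>u'. u' \<in> words \<and> u' \<noteq> [] \<Longrightarrow> card (near u') \<le> card (near u)"
    using ex_has_greatest_nat[of "\<lambda>u. u \<in> words \<and> u \<noteq> []" "[1]" "\<lambda>u. card (near u)" "Suc B"] near_bound
    by (metis less_Suc_eq_le)
  have near_append: "near (w @ u) = (@) w ` near u" if w: "w \<in> words" for w
  proof (rule card_seteq[symmetric])
    show "finite (near (w @ u))" using near_bound u w by auto
    show "(@) w ` near u \<subseteq> near (w @ u)"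
    proof
      fix v' assume "v' \<in> (@) w ` near u"
      then obtain v x y where v: "v' = w @ v" "v \<in> cut (ratio u)" "x \<in> F" "y \<in> F"
          "\<bar>f u x - f v y\<bar> < ratio u" by (auto simp: near_def)
      have "\<bar>f (w @ u) x - f (w @ v) y\<bar> < ratio (w @ u)"
        using v(5) ratio_bounds[OF w] by (simp add: word_map_append f_dist[OF w])
      then show "v' \<in> near (w @ u)"
        using v append_cut[OF w v(2)] by (auto simp: near_def)
    qed
    have "card ((@) w ` near u) = card (near u)" by (intro card_image inj_onI) simp
    then show "card (near (w @ u)) \<le> card ((@) w ` near u)"
      using max[of "w @ u"] u w by auto
  qed
  have "x \<in> f w ` F"
    if *: "w \<in> words" "x \<in> F" "z \<in> F" "\<bar>x - f w (f u z)\<bar> < ratio w * ratio u" for w x z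
  proof -
    have "w @ u \<in> words" using * u by auto
    then have "0 < ratio (w @ u)" "ratio (w @ u) < 1"
      using u ratio_bounds[of "w @ u"] ratio_less_1[of "w @ u"] by auto
    then obtain v y where v: "v \<in> cut (ratio (w @ u))" "y \<in> F" "x = f v y"
      by (rule cut_covers[OF *(2)])
    have "\<bar>f (w @ u) z - f v y\<bar> < ratio (w @ u)"
      using *(4) v(3) by (simp add: word_map_append abs_minus_commute)
    then have "v \<in> near (w @ u)" using v *(3) unfolding near_def by blast
    then obtain v' where v': "v = w @ v'" "v' \<in> near u" using near_append[OF *(1)] by auto
    then have "f v' y \<in> F" using f_in_F v(2) cutD by (auto simp: near_def)
    then show ?thesis using v v' by (auto simp: word_map_append)
  qed
  with u show ?thesis using that by blast
qed

text \<open>If \<open>F\<close> were a point, it would be the fixed point of all the maps, which would then commute;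
  but images of the open set under commuting maps meet.\<close>

lemma two_points:
  obtains p q where "p \<in> F" "q \<in> F" "p \<noteq> q"
proof (cases "\<exists>p. F = {p}")
  case True
  then obtain p where p: "F = {p}" by blast
  obtain U where U: "U \<noteq> {}" "\<And>i. i \<in> {1..N} \<Longrightarrow> \<phi> i ` U \<subseteq> U"
      "\<And>i j. i \<in> {1..N} \<Longrightarrow> j \<in> {1..N} \<Longrightarrow> i \<noteq> j \<Longrightarrow> \<phi> i ` U \<inter> \<phi> j ` U = {}"
    by (rule feasible_open_set) (rule that; simp)
  have N: "1 \<in> {1..N}" "2 \<in> {1..N}" using ifs by (auto simp: similarity_ifs_def)
  have "\<exists>s. \<forall>x. \<phi> i x = p + s * (x - p)" if i: "i \<in> {1..N}" for i
  proof -
    have w: "[i] \<in> words" using i by simp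
    obtain s where s: "\<And>x. f [i] x = f [i] 0 + s * x" by (rule f_affine[OF w]) blast
    have "f [i] p = p" using f_in_F[OF w] p by blast
    then have "f [i] x = p + s * (x - p)" for x
      unfolding s[of x] using s[of p] by (simp only: algebra_simps)
    then have "\<forall>x. \<phi> i x = p + s * (x - p)" by simp
    then show ?thesis by blast
  qed
  from this[OF N(1)] this[OF N(2)] obtain s1 s2 where
    s: "\<And>x. \<phi> 1 x = p + s1 * (x - p)" "\<And>x. \<phi> 2 x = p + s2 * (x - p)" by blast
  obtain x where x: "x \<in> U" using U(1) by blast
  have "\<phi> 1 (\<phi> 2 x) = \<phi> 2 (\<phi> 1 x)" unfolding s by simp
  moreover have "\<phi> 1 (\<phi> 2 x) \<in> \<phi> 1 ` U" "\<phi> 2 (\<phi> 1 x) \<in> \<phi> 2 ` U"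
    using x U(2)[OF N(1)] U(2)[OF N(2)] by blast+
  ultimately have "\<phi> 1 ` U \<inter> \<phi> 2 ` U \<noteq> {}" by (metis disjoint_iff)
  then have False using U(3)[OF N] by simp
  then show ?thesis ..
next
  case False
  then show ?thesis using that F_nonempty by (metis is_singletonI' is_singletonE)
qed

end

lemma ex_gap_between:
  fixes F :: "real set"
  assumes "compact F" "p \<in> F" "q \<in> F" "p < y" "y < q" "y \<notin> F"
  obtains m l where "gap F m l" "p \<le> m - l" "m + l \<le> q"
proof -
  define \<alpha> where "\<alpha> = Sup (F \<inter> {p..y})"
  define \<beta> where "\<beta> = Inf (F \<inter> {y..q})"
  have comp: "compact (F \<inter> {p..y})" "compact (F \<inter> {y..q})"
    using assms(1) by (auto intro: compact_Int)
  have ne: "F \<inter> {p..y} \<noteq> {}" "F \<inter> {y..q} \<noteq> {}" using assms by auto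
  have \<alpha>: "\<alpha> \<in> F \<inter> {p..y}" unfolding \<alpha>_def
    using comp(1) ne(1) by (intro closed_contains_Sup compact_imp_closed) auto
  have \<beta>: "\<beta> \<in> F \<inter> {y..q}" unfolding \<beta>_def
    using comp(2) ne(2) by (intro closed_contains_Inf compact_imp_closed) auto
  have between: "x \<le> \<alpha> \<or> \<beta> \<le> x" if "x \<in> F" for x
  proof (cases "x < p \<or> q < x")
    case True then show ?thesis using \<alpha> \<beta> by auto
  next
    case False
    then show ?thesis using that \<alpha>_def \<beta>_def
      by (cases "x \<le> y") (auto intro!: cSup_upper cInf_lower)
  qed
  have "\<alpha> < \<beta>" using \<alpha> \<beta> assms(6) by (metis Int_iff atLeastAtMost_iff order_le_less less_le_trans)
  then have "gap F ((\<alpha> + \<beta>) / 2) ((\<beta> - \<alpha>) / 2)"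
    using \<alpha> \<beta> between by (auto simp: gap_def field_simps) force+
  then show ?thesis using \<alpha> \<beta> by (intro that) (auto simp: field_simps)
qed

context self_similar_osc
begin

text \<open>Inside a neighbourhood of the piece just found, the maps \<open>f w\<close> copy \<open>F\<close> faithfully, so any gap
  there is turned into a gap of \<open>F\<close> again. Vanishing length of \<open>F\<close> is what provides a gap
  between two nearby points.\<close>

lemma gap_copied_by_all_words:
  assumes null: "measure lebesgue F = 0"
  obtains m l where "gap F m l" "\<And>w. w \<in> words \<Longrightarrow> gap F (f w m) (ratio w * l)"
proof -
  obtain u where u: "u \<in> words" "u \<noteq> []"
    and iso: "\<And>w x z. w \<in> words \<Longrightarrow> x \<in> F \<Longrightarrow> z \<in> F \<Longrightarrow>
       \<bar>x - f w (f u z)\<bar> < ratio w * ratio u \<Longrightarrow> x \<in> f w ` F"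
    by (rule maximal_neighbourhood_piece) blast
  obtain p q where pq: "p \<in> F" "q \<in> F" "p \<noteq> q" by (rule two_points)
  have "\<exists>v\<in>words. ratio v * \<bar>p - q\<bar> < 1"
  proof -
    have r1: "0 < r 1" "r 1 < 1" using letter_ratio[of 1] ifs by (auto simp: similarity_ifs_def)
    have "0 < 1 / \<bar>p - q\<bar>" using pq(3) by simp
    then obtain n where "r 1 ^ n < 1 / \<bar>p - q\<bar>" using real_arch_pow_inv r1 by blast
    then have "r 1 ^ n * \<bar>p - q\<bar> < 1" using pq(3) by (simp add: pos_less_divide_eq)
    moreover have "ratio (replicate n 1) = r 1 ^ n" by (induction n) auto
    moreover have "replicate n 1 \<in> words" using ifs by (induction n) (auto simp: similarity_ifs_def)
    ultimately show ?thesis by (metis (no_types))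
  qed
  then obtain v where v: "v \<in> words" "ratio v * \<bar>p - q\<bar> < 1" by blast
  define P where "P = f v p"
  define Q where "Q = f v q"
  have PQ: "P \<in> F" "Q \<in> F" using f_in_F[OF v(1)] pq by (auto simp: P_def Q_def)
  have PQ_F: "f u P \<in> F" "f u Q \<in> F" using f_in_F[OF u(1)] PQ by auto
  have PQ_dist: "\<bar>f u P - f u Q\<bar> < ratio u"
    unfolding f_dist[OF u(1)] P_def Q_def f_dist[OF v(1)]
    using mult_strict_left_mono[OF v(2), of "ratio u"] ratio_bounds[OF u(1)] by simp
  have "0 < ratio v" "0 < ratio u" using ratio_bounds u v by auto
  then have PQ_ne: "f u P \<noteq> f u Q"
    using f_dist[OF u(1), of P Q] f_dist[OF v(1), of p q] pq(3) unfolding P_def Q_def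
    by (metis abs_eq_0 eq_iff_diff_eq_0 less_irrefl mult_eq_0_iff)
  \<comment> \<open>The two points are closer together than \<open>ratio u\<close>, so every gap between them is in the neighbourhood of
    \<open>f u P\<close> where copies are faithful.\<close>
  define a where "a = min (f u P) (f u Q)"
  define b where "b = max (f u P) (f u Q)"
  have ab: "a \<in> F" "b \<in> F" "a < b" "b - a < ratio u" "a \<le> f u P" "f u P \<le> b"
    using PQ_F PQ_dist PQ_ne by (auto simp: a_def b_def min_def max_def)
  have "\<not> {a<..<b} \<subseteq> F"
  proof
    assume "{a<..<b} \<subseteq> F"
    then have "measure lebesgue {a<..<b} \<le> measure lebesgue F"
      by (intro measure_mono_fmeasurable) (auto intro: lmeasurable_compact compact_F)
    then show False using ab(3) null by (simp add: length_Ioo)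
  qed
  then obtain y where "y \<in> {a<..<b}" and y_notin: "y \<notin> F" by blast
  then have y: "a < y" "y < b" by auto
  obtain m l where ml: "gap F m l" "a \<le> m - l" "m + l \<le> b"
    by (rule ex_gap_between[OF compact_F ab(1,2) y y_notin])
  have "gap F (f w m) (ratio w * l)" if w: "w \<in> words" for w
  proof -
    have rw: "0 < ratio w" using ratio_bounds[OF w] by simp
    have l: "0 < l" and mF: "m - l \<in> F" "m + l \<in> F" using ml(1) by (auto simp: gap_def)
    obtain s where s: "\<bar>s\<bar> = ratio w" "\<And>x. f w x = f w 0 + s * x" by (rule f_affine[OF w]) blast
    have "f w m - s * l = f w (m - l)" "f w m + s * l = f w (m + l)"
      unfolding s(2)[of m] s(2)[of "m - l"] s(2)[of "m + l"] by (simp_all add: algebra_simps)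
    then have "f w m - s * l \<in> F" "f w m + s * l \<in> F"
      using f_in_F[OF w] mF by simp_all
    then have ends: "f w m - ratio w * l \<in> F" "f w m + ratio w * l \<in> F"
      unfolding s(1)[symmetric] by (cases "0 \<le> s"; simp add: abs_if)+
    have "x \<notin> F" if x: "\<bar>x - f w m\<bar> < ratio w * l" for x
    proof
      assume xF: "x \<in> F"
      obtain z where z: "x = f w z" by (rule f_surj[OF w])
      have zm: "\<bar>z - m\<bar> < l" using x rw unfolding z f_dist[OF w] by simp
      then have "\<bar>z - f u P\<bar> < ratio u" using ml(2,3) ab(4-6) by linarith
      then have "\<bar>x - f w (f u P)\<bar> < ratio w * ratio u"
        using rw unfolding z f_dist[OF w] by simp
      from iso[OF w xF PQ(1) this] obtain z' where z': "z' \<in> F" "x = f w z'" by blast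
      have "z' = z" using f_dist[OF w, of z' z] z z'(2) rw by simp
      then show False using gap_avoids[OF ml(1) z'(1)] zm by linarith
    qed
    then have "F \<inter> {f w m - ratio w * l<..<f w m + ratio w * l} = {}"
      by (force simp: abs_less_iff)
    then show ?thesis using ends rw l by (simp add: gap_def)
  qed
  with ml(1) show ?thesis by (rule that)
qed

section \<open>Many gaps of equal length\<close>

lemma parallel_volume_le_card_cut:
  obtains C where "0 < C"
    "\<And>t. 0 < t \<Longrightarrow> t < 1 \<Longrightarrow> parallel_volume F t \<le> C * t * card (cut t)"
proof -
  obtain a where a: "a \<in> F" using F_nonempty by blast
  obtain D where D: "0 \<le> D" "\<And>x. x \<in> F \<Longrightarrow> \<bar>x - a\<bar> \<le> D" using F_within[OF a] by metis
  have "parallel_volume F t \<le> 2 * (D + 2) * t * card (cut t)" if t: "0 < t" "t < 1" for t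
  proof -
    define I where "I w = {f w a - (D + 2) * t<..<f w a + (D + 2) * t}" for w
    have "parallel_set F t \<subseteq> (\<Union>w\<in>cut t. I w)"
    proof
      fix x assume "x \<in> parallel_set F t"
      then obtain z where z: "z \<in> F" "\<bar>x - z\<bar> \<le> t"
        using infdist_attains_inf[OF compact_imp_closed[OF compact_F] F_nonempty, of x]
        unfolding parallel_set_def dist_real_def by (metis mem_Collect_eq)
      obtain w y where w: "w \<in> cut t" "y \<in> F" "z = f w y" by (rule cut_covers[OF z(1) t])
      have ww: "w \<in> words" "ratio w \<le> t" using cutD[OF w(1)] by auto
      have "\<bar>z - f w a\<bar> \<le> t * D"
        unfolding w(3) f_dist[OF ww(1)]
        using D(2)[OF w(2)] ww(2) t ratio_bounds[OF ww(1)] by (intro mult_mono) auto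
      then have "\<bar>x - f w a\<bar> \<le> t * D + t" using z(2) by linarith
      also have "\<dots> < (D + 2) * t" using t by (simp add: algebra_simps)
      finally have "x \<in> I w" by (auto simp: I_def abs_less_iff)
      then show "x \<in> (\<Union>w\<in>cut t. I w)" using w(1) by blast
    qed
    then have "parallel_volume F t \<le> measure lebesgue (\<Union>w\<in>cut t. I w)"
      unfolding parallel_volume_def
      by (intro measure_mono_fmeasurable fmeasurable.finite_UN finite_cut t)
         (simp_all add: I_def bounded_set_imp_lmeasurable fmeasurableD[OF lmeasurable_compact]
            parallel_set_compact compact_F F_nonempty)
    also have "\<dots> \<le> (\<Sum>w\<in>cut t. measure lebesgue (I w))"
      by (intro measure_UNION_le finite_cut t) (simp add: I_def)
    also have "\<dots> = 2 * (D + 2) * t * card (cut t)"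
      using D(1) t by (simp add: I_def length_Ioo)
    finally show ?thesis .
  qed
  then show ?thesis using D(1) by (intro that[of "2 * (D + 2)"]) auto
qed

text \<open>The logarithms of the ratios of the words in a stopping set lie in an interval of fixed length
  and in a discrete group, whose distinct elements keep a fixed distance from each other.\<close>

lemma lattice_bounded_ratio_values:
  assumes "lattice_ratios N r"
  obtains K :: nat where "\<And>t. 0 < t \<Longrightarrow> card (ratio ` cut t) \<le> K"
proof -
  define G where "G = group_closure ((\<lambda>i. ln (r i)) ` {1..N})"
  have "0 isolated_in G" using assms unfolding lattice_ratios_def G_def
    by (intro discreteD) auto
  then obtain e where e: "0 < e" "\<And>y. y \<in> G \<Longrightarrow> \<bar>y\<bar> < e \<Longrightarrow> y = 0"
    unfolding isolated_in_dist_Ex_iff dist_real_def by (metis abs_minus_cancel diff_0)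
  have ln_G: "ln (ratio w) \<in> G" if "w \<in> words" for w
    using that
  proof (induction w)
    case (Cons i w)
    have "0 < r i" "0 < ratio w" using letter_ratio ratio_bounds Cons.hyps by auto
    then have "ln (ratio (i # w)) = ln (r i) + ln (ratio w)" by (simp add: ln_mult)
    moreover have "ln (r i) \<in> G" unfolding G_def using Cons.hyps by (intro group_closure.base) auto
    ultimately show ?case using Cons.IH unfolding G_def by (auto intro: group_closure_add)
  qed (simp add: G_def)
  obtain c where c: "0 < c" "\<And>t w. 0 < t \<Longrightarrow> w \<in> cut t \<Longrightarrow> c * t < ratio w"
    by (rule cut_ratio_lower_bound) blast
  have "card (ratio ` cut t) \<le> nat \<lfloor>- ln c / e\<rfloor> + 1" if t: "0 < t" for t
  proof -
    \<comment> \<open>Cells of width \<open>e\<close> on the logarithmic scale contain at most one value each.\<close>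
    define g where "g \<rho> = nat \<lfloor>(ln t - ln \<rho>) / e\<rfloor>" for \<rho>
    have nonneg: "0 \<le> (ln t - ln (ratio w)) / e" if "w \<in> cut t" for w
      using cutD[OF that] ratio_bounds[of w] e t by simp
    have "inj_on g (ratio ` cut t)"
    proof (rule inj_onI)
      fix \<rho> \<rho>' assume "\<rho> \<in> ratio ` cut t" "\<rho>' \<in> ratio ` cut t" and eq: "g \<rho> = g \<rho>'"
      then obtain w w' where w: "w \<in> cut t" "\<rho> = ratio w" "w' \<in> cut t" "\<rho>' = ratio w'" by blast
      have "\<lfloor>(ln t - ln \<rho>) / e\<rfloor> = \<lfloor>(ln t - ln \<rho>') / e\<rfloor>"
        using eq nonneg[OF w(1)] nonneg[OF w(3)] unfolding g_def w(2,4) by (simp add: eq_nat_nat_iff)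
      then have "\<bar>(ln t - ln \<rho>) / e - (ln t - ln \<rho>') / e\<bar> < 1" by linarith
      then have "\<bar>(ln \<rho>' - ln \<rho>) / e\<bar> < 1" by (simp add: diff_divide_distrib)
      then have "\<bar>ln \<rho>' - ln \<rho>\<bar> < e" using e(1) by (simp add: abs_divide)
      moreover have "ln \<rho>' - ln \<rho> \<in> G"
        using ln_G cutD w unfolding G_def by (auto intro: group_closure.diff)
      ultimately have "ln \<rho>' = ln \<rho>" using e(2) by force
      then show "\<rho> = \<rho>'" using w cutD ratio_bounds by simp
    qed
    then have "card (ratio ` cut t) = card (g ` ratio ` cut t)" by (simp add: card_image)
    also have "\<dots> \<le> card {..nat \<lfloor>- ln c / e\<rfloor>}"
    proof (rule card_mono)
      show "g ` ratio ` cut t \<subseteq> {..nat \<lfloor>- ln c / e\<rfloor>}"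
      proof
        fix k assume "k \<in> g ` ratio ` cut t"
        then obtain w where w: "w \<in> cut t" and k: "k = g (ratio w)" by blast
        have "0 < c * t" "c * t < ratio w" using c(1) c(2)[OF t w] t by auto
        then have "ln (c * t) < ln (ratio w)" by simp
        then have "(ln t - ln (ratio w)) / e \<le> - ln c / e"
          using c(1) t e(1) by (intro divide_right_mono) (auto simp: ln_mult)
        then have "g (ratio w) \<le> nat \<lfloor>- ln c / e\<rfloor>"
          unfolding g_def by (intro nat_mono floor_mono)
        then show "k \<in> {..nat \<lfloor>- ln c / e\<rfloor>}" unfolding k atMost_iff .
      qed
    qed simp
    finally show ?thesis by simp
  qed
  then show ?thesis by (rule that)
qed

end

lemma card_le_card_image_times_fibre:
  assumes "finite A" "\<And>y. y \<in> g ` A \<Longrightarrow> card {x \<in> A. g x = y} \<le> B"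
  shows "card A \<le> card (g ` A) * B"
proof -
  have "A = (\<Union>y\<in>g ` A. {x \<in> A. g x = y})" by auto
  then have "card A \<le> (\<Sum>y\<in>g ` A. card {x \<in> A. g x = y})"
    using card_UN_le[of "g ` A" "\<lambda>y. {x \<in> A. g x = y}"] assms(1) by simp
  also have "\<dots> \<le> card (g ` A) * B" using sum_bounded_above[of "g ` A" _ B] assms(2) by simp
  finally show ?thesis .
qed

lemma ex_large_fibre:
  assumes "finite A" "A \<noteq> {}" "card (g ` A) \<le> K"
  obtains y where "y \<in> g ` A" "card A \<le> K * card {x \<in> A. g x = y}"
proof -
  define h where "h y = card {x \<in> A. g x = y}" for y
  have fin: "finite (h ` g ` A)" "h ` g ` A \<noteq> {}" using assms by auto
  obtain y where y: "y \<in> g ` A" "h y = Max (h ` g ` A)" using Max_in[OF fin] by (metis imageE)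
  have "card A \<le> card (g ` A) * h y"
    unfolding y(2) using fin(1) assms(1) by (intro card_le_card_image_times_fibre) (auto simp: h_def)
  also have "\<dots> \<le> K * h y" using assms(3) by simp
  finally show ?thesis using that y(1) by (simp add: h_def)
qed

context self_similar_osc
begin

text \<open>Of the copies of one gap by the words of a stopping set, a fixed proportion has the same length,
  since only boundedly many lengths occur, and boundedly many words give the same copy. So the
  gaps of one particular half length \<open>\<epsilon>\<close>, comparable to \<open>t\<close>, are as numerous as the parallel
  volume permits.\<close>

lemma many_equal_gaps:
  assumes lat: "lattice_ratios N r" and null: "measure lebesgue F = 0"
  obtains c a where "0 < c" "0 < a"
    "\<And>t::real. 0 < t \<Longrightarrow> t < 1 \<Longrightarrow> \<exists>\<epsilon> M. 0 < \<epsilon> \<and> \<epsilon> * a \<le> t \<and> finite M \<and> (\<forall>m\<in>M. gap F m \<epsilon>) \<and>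
       c * parallel_volume F (\<epsilon> * a) \<le> \<epsilon> * card M"
proof -
  obtain m l where ml: "gap F m l" "\<And>w. w \<in> words \<Longrightarrow> gap F (f w m) (ratio w * l)"
    using gap_copied_by_all_words[OF null] by metis
  have l: "0 < l" and mF: "m - l \<in> F" using ml(1) by (auto simp: gap_def)
  obtain C where C: "0 < C"
    "\<And>t. 0 < t \<Longrightarrow> t < 1 \<Longrightarrow> parallel_volume F t \<le> C * t * card (cut t)"
    by (rule parallel_volume_le_card_cut) blast
  obtain K :: nat where K: "\<And>t. 0 < t \<Longrightarrow> card (ratio ` cut t) \<le> K"
    by (rule lattice_bounded_ratio_values[OF lat]) blast
  have "0 \<le> l" using l by simp
  then obtain B :: nat where B: "\<And>t z. 0 < t \<Longrightarrow> finite {w \<in> cut t. \<exists>x\<in>F. \<bar>f w x - z\<bar> \<le> l * t} \<and>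
       card {w \<in> cut t. \<exists>x\<in>F. \<bar>f w x - z\<bar> \<le> l * t} \<le> B"
    by (rule bounded_multiplicity) blast
  obtain c where c: "0 < c" "\<And>t w. 0 < t \<Longrightarrow> w \<in> cut t \<Longrightarrow> c * t < ratio w"
    by (rule cut_ratio_lower_bound) blast
  have K0: "0 < K" and B0: "0 < B" if t: "0 < t" "t < 1" for t :: real
  proof -
    obtain w y where w: "w \<in> cut t" "y \<in> F" "m - l = f w y" by (rule cut_covers[OF mF t])
    have "card (ratio ` cut t) > 0" using w(1) finite_cut[OF t(1)] by (auto simp: card_gt_0_iff)
    then show "0 < K" using K[OF t(1)] by linarith
    define S where "S = {w \<in> cut t. \<exists>x\<in>F. \<bar>f w x - (m - l)\<bar> \<le> l * t}"
    have "\<bar>f w y - (m - l)\<bar> \<le> l * t" using w(3) l t by simp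
    then have "w \<in> S" unfolding S_def using w(1,2) by blast
    moreover have "finite S" "card S \<le> B" unfolding S_def using B[OF t(1)] by auto
    ultimately show "0 < B" using card_gt_0_iff[of S] by auto
  qed
  have K0: "0 < K" and B0: "0 < B" using K0[of "1/2"] B0[of "1/2"] by auto
  define k where "k = c * l / (C * K * B)"
  have k: "0 < k" using c(1) l C(1) K0 B0 by (simp add: k_def)
  have "\<exists>\<epsilon> M. 0 < \<epsilon> \<and> \<epsilon> * (1 / l) \<le> t \<and> finite M \<and> (\<forall>m\<in>M. gap F m \<epsilon>) \<and>
       k * parallel_volume F (\<epsilon> * (1 / l)) \<le> \<epsilon> * card M" if t: "0 < t" "t < 1" for t :: real
  proof -
    have fin: "finite (cut t)" by (rule finite_cut[OF t(1)])
    have ne: "cut t \<noteq> {}" using cut_covers[OF mF t] by blast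
    obtain \<rho> where \<rho>: "\<rho> \<in> ratio ` cut t" "card (cut t) \<le> K * card {w \<in> cut t. ratio w = \<rho>}"
      by (rule ex_large_fibre[OF fin ne K[OF t(1)]])
    define W where "W = {w \<in> cut t. ratio w = \<rho>}"
    define M where "M = (\<lambda>w. f w m) ` W"
    have \<rho>t: "0 < \<rho>" "\<rho> \<le> t" "c * t < \<rho>"
      using \<rho>(1) cutD ratio_bounds c(2)[OF t(1)] by auto
    have "card W \<le> card M * B"
      unfolding M_def
    proof (rule card_le_card_image_times_fibre)
      show "finite W" using fin by (simp add: W_def)
      fix z assume "z \<in> (\<lambda>w. f w m) ` W"
      \<comment> \<open>Words with the same copy have pieces near the common midpoint \<open>z\<close>.\<close>
      have "\<bar>f w (m - l) - f w m\<bar> \<le> l * t" if "w \<in> W" for w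
      proof -
        have w: "w \<in> words" "ratio w = \<rho>" using that cutD by (auto simp: W_def)
        show ?thesis unfolding f_dist[OF w(1)] w(2) using l \<rho>t by simp
      qed
      then have sub: "{w \<in> W. f w m = z} \<subseteq> {w \<in> cut t. \<exists>x\<in>F. \<bar>f w x - z\<bar> \<le> l * t}"
        using mF by (auto simp: W_def)
      show "card {w \<in> W. f w m = z} \<le> B"
        using card_mono[OF _ sub] B[OF t(1), of z] by linarith
    qed
    then have "card (cut t) \<le> K * (card M * B)"
      using \<rho>(2) by (fold W_def) (meson le_trans mult_le_mono2)
    then have "real (card (cut t)) \<le> real (K * (card M * B))" by (rule of_nat_mono)
    then have cardM: "real (card (cut t)) \<le> K * B * card M" by (simp add: mult.assoc mult.commute mult.left_commute)
    have "parallel_volume F \<rho> \<le> parallel_volume F t"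
      by (rule parallel_volume_mono[OF compact_F F_nonempty \<rho>t(2)])
    also have "\<dots> \<le> C * t * card (cut t)" by (rule C(2)[OF t])
    also have "\<dots> \<le> C * t * (K * B * card M)" using cardM C(1) t by (intro mult_left_mono) auto
    finally have "k * parallel_volume F \<rho> \<le> k * (C * t * (K * B * card M))"
      using k by simp
    also have "\<dots> = c * t * l * card M" using C(1) K0 B0 by (simp add: k_def)
    also have "\<dots> \<le> \<rho> * l * card M" using \<rho>t(3) l by (intro mult_right_mono) auto
    finally have "k * parallel_volume F (\<rho> * l * (1 / l)) \<le> \<rho> * l * card M" using l by simp
    moreover have "\<forall>x\<in>M. gap F x (\<rho> * l)" using ml(2) cutD by (auto simp: M_def W_def)
    moreover have "finite M" using fin by (simp add: M_def W_def)
    moreover have "0 < \<rho> * l" "\<rho> * l * (1 / l) \<le> t" using \<rho>t l by auto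
    ultimately show ?thesis by blast
  qed
  then show ?thesis using k l by (intro that[of k "1 / l"]) auto
qed

end

section \<open>Failure of Minkowski measurability\<close>

theorem theorem3p1:
  fixes N :: nat and \<phi> :: "nat \<Rightarrow> real \<Rightarrow> real" and r :: "nat \<Rightarrow> real" and F :: "real set"
  assumes "similarity_ifs N \<phi> r"
    and "open_set_condition N \<phi>"
    and "lattice_ratios N r"
    and "self_similar_set N \<phi> F"
    and "minkowski_dim F < 1"
  shows "\<not> minkowski_measurable F"
proof
  assume "minkowski_measurable F"
  then obtain M where M: "0 < M"
    "((\<lambda>\<epsilon>. \<epsilon> powr (minkowski_dim F - 1) * parallel_volume F \<epsilon>) \<longlongrightarrow> M) (at_right 0)"
    by (auto simp: minkowski_measurable_def has_minkowski_content_def)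
  interpret self_similar_osc N \<phi> r F
    using assms by unfold_locales
  define p where "p = 1 - minkowski_dim F"
  have p: "0 < p" using assms(5) by (simp add: p_def)
  have lim: "((\<lambda>\<epsilon>. \<epsilon> powr (- p) * parallel_volume F \<epsilon>) \<longlongrightarrow> M) (at_right 0)"
    using M(2) by (simp add: p_def)
  have null: "measure lebesgue F = 0"
  proof -
    have "((\<lambda>\<epsilon>::real. \<epsilon> powr p) \<longlongrightarrow> 0) (at_right 0)"
      using p by (auto intro!: tendsto_eq_intros simp: eventually_at_filter)
    from tendsto_mult[OF this lim]
    have "((\<lambda>\<epsilon>. \<epsilon> powr p * (\<epsilon> powr (- p) * parallel_volume F \<epsilon>)) \<longlongrightarrow> 0) (at_right 0)" by simp
    moreover have "\<forall>\<^sub>F \<epsilon> in at_right 0. measure lebesgue F \<le> \<epsilon> powr p * (\<epsilon> powr (- p) * parallel_volume F \<epsilon>)"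
    proof (rule eventually_at_right_less[THEN eventually_mono])
      fix \<epsilon> :: real assume "0 < \<epsilon>"
      have "measure lebesgue F \<le> parallel_volume F \<epsilon>"
        unfolding parallel_volume_def using \<open>0 < \<epsilon>\<close>
        by (intro measure_mono_fmeasurable)
           (auto simp: parallel_set_def intro: fmeasurableD lmeasurable_compact compact_F
             lmeasurable_compact[OF parallel_set_compact[OF compact_F F_nonempty], unfolded parallel_set_def])
      also have "\<dots> = \<epsilon> powr p * (\<epsilon> powr (- p) * parallel_volume F \<epsilon>)"
        using \<open>0 < \<epsilon>\<close> by (simp add: powr_minus)
      finally show "measure lebesgue F \<le> \<epsilon> powr p * (\<epsilon> powr (- p) * parallel_volume F \<epsilon>)" .
    qed
    ultimately have "measure lebesgue F \<le> 0"
      by (intro tendsto_lowerbound[where F="at_right 0"]) auto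
    then show ?thesis by (simp add: antisym)
  qed
  obtain c a where ca: "0 < c" "0 < a"
    "\<And>t::real. 0 < t \<Longrightarrow> t < 1 \<Longrightarrow> \<exists>\<epsilon> M. 0 < \<epsilon> \<and> \<epsilon> * a \<le> t \<and> finite M \<and> (\<forall>m\<in>M. gap F m \<epsilon>) \<and>
       c * parallel_volume F (\<epsilon> * a) \<le> \<epsilon> * card M"
    by (rule many_equal_gaps[OF assms(3) null]) blast
  define t :: "nat \<Rightarrow> real" where "t n = inverse (real (Suc (Suc n)))" for n
  have t: "0 < t n" "t n < 1" for n by (auto simp: t_def field_simps)
  have "\<exists>\<epsilon> M. \<forall>n. 0 < \<epsilon> n \<and> \<epsilon> n * a \<le> t n \<and> finite (M n) \<and> (\<forall>m\<in>M n. gap F m (\<epsilon> n)) \<and>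
       c * parallel_volume F (\<epsilon> n * a) \<le> \<epsilon> n * card (M n)"
    using ca(3)[OF t] by metis
  then obtain e :: "nat \<Rightarrow> real" and Mid where
    e: "\<And>n. 0 < e n" "\<And>n. e n * a \<le> t n" and
    Mid: "\<And>n. finite (Mid n)" "\<And>n m. m \<in> Mid n \<Longrightarrow> gap F m (e n)"
      "\<And>n. c * parallel_volume F (e n * a) \<le> e n * card (Mid n)"
    by blast
  have "e \<longlonglongrightarrow> 0"
  proof (rule tendsto_sandwich)
    show "\<forall>\<^sub>F n in sequentially. 0 \<le> e n" using e(1) by (simp add: less_imp_le)
    show "\<forall>\<^sub>F n in sequentially. e n \<le> t n / a" using e(2) ca(2) by (simp add: pos_le_divide_eq)
    have "t \<longlonglongrightarrow> 0" unfolding t_def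
      by (rule LIMSEQ_Suc[OF LIMSEQ_inverse_real_of_nat])
    then show "(\<lambda>n. t n / a) \<longlonglongrightarrow> 0" using ca(2) by (auto intro: tendsto_eq_intros)
  qed auto
  moreover have "parallel_volume F (e n * (1 + h)) + parallel_volume F (e n * (1 - h))
      + 2 * c * h * parallel_volume F (e n * a) \<le> 2 * parallel_volume F (e n)"
    if h: "0 < h" "h < 1" for n h
  proof -
    have "parallel_volume F (e n + e n * h) + parallel_volume F (e n - e n * h)
        + 2 * (e n * h) * card (Mid n) \<le> 2 * parallel_volume F (e n)"
      using e(1)[of n] h by (intro parallel_volume_kink compact_F F_nonempty Mid) auto
    moreover have "2 * c * h * parallel_volume F (e n * a) \<le> 2 * (e n * h) * card (Mid n)"
      using mult_left_mono[OF Mid(3)[of n], of "2 * h"] h by (simp add: algebra_simps)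
    ultimately show ?thesis by (simp add: algebra_simps)
  qed
  ultimately show False
    using no_kinks_in_power_asymptotics[OF lim M(1), of "2 * c" a e] ca(1,2) e(1) by simp
qed

end
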